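(* If $T$ is a tree on $n$ vertices, then the probability $\mathcal{P}(T)$ that the first player wins the tree search game on $T$ when both players play with an optimal strategy is $$\mathcal{P}(T) = \frac{1}{2} + \frac{1}{2n}\cdot \mathbf{1}_{n \text{ is odd}}.$$
   Context: A tree is a connected acyclic undirected graph with a finite, positive number of vertices. For a tree $T$, $|T|$ is its number of vertices; for $v\in V(T)$, $T\smallsetminus v$ is the forest obtained by deleting $v$ and its incident edges (it has $\deg(v)$ components, each a tree). Tree search game on $T$: one vertex of $T$ is selected uniformly at random as the target, unknown to both players. The two players alternately guess vertices. If the guess $v$ is the target, the player who made it wins. Otherwise both players are informed which component of $T\smallsetminus v$ contains the target, and the game continues on that component with the other player to move. $\mathcal{P}(T)$ denotes the probability that the first player wins on $T$ when both players play to maximize their own probability of winning. Equivalently, $\mathcal{P}$ is determined recursively by $$\mathcal{P}(T)=\max_{v\in V(T)}\Bigl(\frac1n+\sum_{T'}\frac{|T'|}{n}\bigl(1-\mathcal{P}(T')\bigr)\Bigr),\qquad n=|T|,$$ where $T'$ ranges over the components of $T\smallsetminus v$ (an empty sum is $0$). $\mathbf{1}_{A}$ is $1$ if the condition $A$ holds and $0$ otherwise. *)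

theory Defs
  imports Complex_Main "Graph_Theory.Graph_Theory"
begin

text \<open>
  Undirected graphs are modelled by the locale \<^locale>\<open>graph\<close>: finite symmetric digraphs
  without loops or parallel arcs. An undirected edge is then a pair of opposite arcs,
  which \<^const>\<open>pre_digraph.cycle\<close> counts as a cycle of length 2; hence the library predicate
  \<^const>\<open>tree\<close> fails on every such graph that has an edge, and the undirected cycles
  are the cycles of length at least 3. \<^const>\<open>Digraph_Component.connected\<close> includes
  that there is at least one vertex.
\<close>
definition undirected_tree :: "('a, 'b) pre_digraph \<Rightarrow> bool" where
  "undirected_tree T \<longleftrightarrow> graph T \<and> Digraph_Component.connected T \<and>
     \<not> (\<exists>p. pre_digraph.cycle T p \<and> 3 \<le> length p)"

text \<open>In a symmetric digraph the strongly connected components are the connected components.\<close>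
abbreviation components_without ::
    "('a, 'b) pre_digraph \<Rightarrow> 'a \<Rightarrow> ('a, 'b) pre_digraph set" where
  "components_without G v \<equiv> pre_digraph.sccs (pre_digraph.del_vert G v)"

lemma components_without_verts:
  assumes "H \<in> components_without G v"
  shows "verts H \<subseteq> verts G - {v}" "verts H \<noteq> {}"
proof -
  have "induced_subgraph H (pre_digraph.del_vert G v)" "strongly_connected H"
    using assms by (auto simp: pre_digraph.sccs_def)
  then show "verts H \<subseteq> verts G - {v}" "verts H \<noteq> {}"
    by (auto simp: induced_subgraph_def subgraph_def pre_digraph.verts_del_vert
        strongly_connected_def)
qed

lemma card_components_without_less:
  assumes "finite (verts G)" "v \<in> verts G" "H \<in> components_without G v"
  shows "card (verts H) < card (verts G)"
  using components_without_verts[OF assms(3)] assms(1,2) by (intro psubset_card_mono) auto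

text \<open>
  The winning probability of the player to move under optimal play. The value 0 outside the
  nonempty finite graphs is a dummy needed for totality.
\<close>
function search_value :: "('a, 'b) pre_digraph \<Rightarrow> real" where
  "search_value G =
    (if finite (verts G) \<and> verts G \<noteq> {}
     then Max ((\<lambda>v. 1 / real (card (verts G)) +
             (\<Sum>H \<in> components_without G v.
                real (card (verts H)) / real (card (verts G)) * (1 - search_value H))) ` verts G)
     else 0)"
  by auto
termination
  by (relation "measure (\<lambda>G. card (verts G))") (auto intro: card_components_without_less)

declare search_value.simps [simp del]

text \<open>
  The remainder relates \<^const>\<open>search_value\<close> to the game itself. A strategy picks the guess
  for the player to move in each position (the current component). In
  \<open>mover_wins \<sigma> \<tau> G t\<close> the player to move uses \<open>\<sigma>\<close>, the opponent \<open>\<tau>\<close>, and the target is \<open>t\<close>.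
\<close>
definition strategy :: "(('a, 'b) pre_digraph \<Rightarrow> 'a) \<Rightarrow> bool" where
  "strategy \<sigma> \<longleftrightarrow> (\<forall>G. finite (verts G) \<and> verts G \<noteq> {} \<longrightarrow> \<sigma> G \<in> verts G)"

function mover_wins ::
    "(('a, 'b) pre_digraph \<Rightarrow> 'a) \<Rightarrow> (('a, 'b) pre_digraph \<Rightarrow> 'a) \<Rightarrow>
     ('a, 'b) pre_digraph \<Rightarrow> 'a \<Rightarrow> bool" where
  "mover_wins \<sigma> \<tau> G t =
    (if finite (verts G) \<and> \<sigma> G \<in> verts G
     then \<sigma> G = t \<or>
       (\<exists>H \<in> components_without G (\<sigma> G). t \<in> verts H \<and> \<not> mover_wins \<tau> \<sigma> H t)
     else False)"
  by auto
termination
  by (relation "measure (\<lambda>(_, _, G, _). card (verts G))")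
    (auto intro: card_components_without_less)

declare mover_wins.simps [simp del]

text \<open>The target is uniformly distributed on the vertices.\<close>
definition win_prob ::
    "(('a, 'b) pre_digraph \<Rightarrow> 'a) \<Rightarrow> (('a, 'b) pre_digraph \<Rightarrow> 'a) \<Rightarrow> ('a, 'b) pre_digraph \<Rightarrow> real"
  where "win_prob \<sigma> \<tau> G = real (card {t \<in> verts G. mover_wins \<sigma> \<tau> G t}) / real (card (verts G))"

lemma graph_del_vert:
  assumes "graph G"
  shows "graph (pre_digraph.del_vert G v)"
proof -
  interpret graph G by fact
  let ?D = "pre_digraph.del_vert G v"
  interpret D: digraph ?D
  proof (intro digraph.intro loopfree_digraph.intro nomulti_digraph.intro
      loopfree_digraph_axioms.intro nomulti_digraph_axioms.intro
      fin_digraph_del_vert wf_digraph_del_vert)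
    show "tail ?D e \<noteq> head ?D e" if "e \<in> arcs ?D" for e
      using that no_loops by (simp add: del_vert_simps)
    show "e1 = e2" if "e1 \<in> arcs ?D" "e2 \<in> arcs ?D" "arc_to_ends ?D e1 = arc_to_ends ?D e2" for e1 e2
      using that no_multi_arcs[of e1 e2] by (simp add: arcs_del_vert ends_del_vert)
  qed
  have symD: "symmetric ?D"
    unfolding symmetric_conv
  proof
    fix e1 assume "e1 \<in> arcs ?D"
    then have e1: "e1 \<in> arcs G" "tail G e1 \<noteq> v" "head G e1 \<noteq> v"
      by (auto simp: del_vert_simps)
    then obtain e2 where "e2 \<in> arcs G" "tail G e1 = head G e2" "head G e1 = tail G e2"
      using sym_arcs unfolding symmetric_conv by blast
    with e1 show "\<exists>e2\<in>arcs ?D. tail ?D e1 = head ?D e2 \<and> head ?D e1 = tail ?D e2"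
      unfolding del_vert_simps by auto
  qed
  show ?thesis
    using symD by (rule D.graphI)
qed

lemma
  assumes "graph G"
  shows components_without_graph: "H \<in> components_without G v \<Longrightarrow> graph H"
    and finite_components_without: "finite (components_without G v)"
    and Un_components_without: "\<Union> (verts ` components_without G v) = verts G - {v}"
    and components_without_disjoint:
      "H \<in> components_without G v \<Longrightarrow> H' \<in> components_without G v \<Longrightarrow> H \<noteq> H' \<Longrightarrow>
       verts H \<inter> verts H' = {}"
proof -
  let ?D = "pre_digraph.del_vert G v"
  have D: "graph ?D" using assms by (rule graph_del_vert)
  then have dD: "digraph ?D" and sD: "sym_digraph ?D"
    by (simp_all add: graph_def pseudo_graph_def)
  then have fD: "fin_digraph ?D" and wD: "wf_digraph ?D" and symD: "symmetric ?D"
    by (simp_all add: digraph_def sym_digraph_def sym_digraph_axioms_def)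
  show "graph H" if "H \<in> components_without G v"
  proof -
    have ind: "induced_subgraph H ?D" using that by (auto simp: pre_digraph.sccs_def)
    show ?thesis
      using digraph.digraphI_induced[OF dD ind] induced_graph_imp_symmetric[OF symD ind]
      by (rule digraph.graphI)
  qed
  have "finite (verts ` components_without G v)"
    using fin_digraph.finite_sccs_verts[OF fD] by (simp only: wf_digraph.sccs_verts_conv[OF wD])
  then show "finite (components_without G v)"
    using wf_digraph.inj_on_verts_sccs[OF wD] by (rule finite_imageD)
  show "\<Union> (verts ` components_without G v) = verts G - {v}"
  proof (rule antisym)
    show "\<Union> (verts ` components_without G v) \<subseteq> verts G - {v}"
      by (rule UN_least) (rule components_without_verts(1))
    show "verts G - {v} \<subseteq> \<Union> (verts ` components_without G v)"
    proof
      fix x assume "x \<in> verts G - {v}"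
      then have "x \<in> verts ?D" by (simp only: pre_digraph.verts_del_vert)
      from sym_digraph.scc_for_vert_ex[OF sD this]
      obtain H where H: "H \<in> components_without G v" "x \<in> verts H" by (elim exE conjE)
      then show "x \<in> \<Union> (verts ` components_without G v)" by (rule UN_I)
    qed
  qed
  show "verts H \<inter> verts H' = {}"
    if "H \<in> components_without G v" "H' \<in> components_without G v" "H \<noteq> H'"
    using wf_digraph.scc_disj[OF wD that] .
qed

lemma win_prob_rec:
  assumes "graph G" "\<sigma> G \<in> verts G"
  shows "win_prob \<sigma> \<tau> G = 1 / real (card (verts G)) +
    (\<Sum>H \<in> components_without G (\<sigma> G).
       real (card (verts H)) / real (card (verts G)) * (1 - win_prob \<tau> \<sigma> H))"
proof -
  interpret graph G by fact
  define C where "C = components_without G (\<sigma> G)"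
  let ?n = "real (card (verts G))"
  have disj: "verts H \<inter> verts H' = {}" if "H \<in> C" "H' \<in> C" "H \<noteq> H'" for H H'
    using that unfolding C_def by (rule components_without_disjoint[OF assms(1)])
  have finC: "finite C"
    unfolding C_def by (rule finite_components_without[OF assms(1)])
  have V: "verts H \<subseteq> verts G - {\<sigma> G}" "verts H \<noteq> {}" if "H \<in> C" for H
    using that unfolding C_def by (rule components_without_verts)+
  have fin: "finite (verts H)" if "H \<in> C" for H
    using V(1)[OF that] by (rule finite_subset) auto
  define L where "L H = {t \<in> verts H. \<not> mover_wins \<tau> \<sigma> H t}" for H
  have "{t \<in> verts G. mover_wins \<sigma> \<tau> G t} = insert (\<sigma> G) (\<Union>H \<in> C. L H)"
    using assms(2) V(1)
    by (auto simp: mover_wins.simps[of \<sigma> \<tau> G] L_def C_def[symmetric] split: if_splits)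
  moreover have "\<sigma> G \<notin> (\<Union>H \<in> C. L H)"
    using V(1) by (auto simp: L_def)
  moreover have "card (\<Union>H \<in> C. L H) = (\<Sum>H \<in> C. card (L H))"
  proof (rule card_UN_disjoint)
    show "finite C" by (rule finC)
    show "\<forall>H \<in> C. finite (L H)"
      using fin by (simp add: L_def)
    show "\<forall>H \<in> C. \<forall>H' \<in> C. H \<noteq> H' \<longrightarrow> L H \<inter> L H' = {}"
    proof (intro ballI impI)
      fix H H' assume "H \<in> C" "H' \<in> C" "H \<noteq> H'"
      then have "verts H \<inter> verts H' = {}" by (rule disj)
      then show "L H \<inter> L H' = {}" unfolding L_def by blast
    qed
  qed
  moreover have "finite (\<Union>H \<in> C. L H)"
    using finC fin by (intro finite_UN_I) (simp_all add: L_def)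
  ultimately have "card {t \<in> verts G. mover_wins \<sigma> \<tau> G t} = 1 + (\<Sum>H \<in> C. card (L H))"
    by simp
  moreover have "real (card (L H)) = real (card (verts H)) * (1 - win_prob \<tau> \<sigma> H)"
    if "H \<in> C" for H
  proof -
    let ?W = "{t \<in> verts H. mover_wins \<tau> \<sigma> H t}"
    have "L H = verts H - ?W" by (auto simp: L_def)
    then have "card (L H) = card (verts H) - card ?W" "card ?W \<le> card (verts H)"
      using fin[OF that] by (auto intro!: card_Diff_subset card_mono)
    moreover have "card (verts H) > 0"
      using fin[OF that] V(2)[OF that] by (simp add: card_gt_0_iff)
    ultimately show ?thesis
      by (simp add: win_prob_def field_simps)
  qed
  ultimately show ?thesis
    unfolding C_def[symmetric] by (simp add: win_prob_def add_divide_distrib sum_divide_distrib)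
qed

text \<open>
  The recursion computes the value of the game: a single strategy is optimal for both players
  on every graph.
\<close>
theorem search_value_game_value:
  "\<exists>\<sigma> :: ('a, 'b) pre_digraph \<Rightarrow> 'a. strategy \<sigma> \<and>
     (\<forall>\<tau> G. strategy \<tau> \<and> graph G \<and> verts G \<noteq> {} \<longrightarrow>
        search_value G \<le> win_prob \<sigma> \<tau> G \<and> win_prob \<tau> \<sigma> G \<le> search_value G)"
proof -
  define g where "g G v = 1 / real (card (verts G)) +
      (\<Sum>H \<in> components_without G v.
         real (card (verts H)) / real (card (verts G)) * (1 - search_value H))"
    for G :: "('a, 'b) pre_digraph" and v
  have val: "search_value G = Max (g G ` verts G)" if "finite (verts G)" "verts G \<noteq> {}"
    for G :: "('a, 'b) pre_digraph"
    using that by (subst search_value.simps) (simp add: g_def)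
  define \<sigma> where "\<sigma> G = (SOME v. v \<in> verts G \<and> g G v = search_value G)"
    for G :: "('a, 'b) pre_digraph"
  have \<sigma>: "\<sigma> G \<in> verts G \<and> g G (\<sigma> G) = search_value G"
    if "finite (verts G)" "verts G \<noteq> {}" for G :: "('a, 'b) pre_digraph"
  proof -
    have "search_value G \<in> g G ` verts G"
      unfolding val[OF that] using that by (intro Max_in) auto
    then have "\<exists>v. v \<in> verts G \<and> g G v = search_value G" by auto
    then show ?thesis unfolding \<sigma>_def by (rule someI_ex)
  qed
  have "search_value G \<le> win_prob \<sigma> \<tau> G \<and> win_prob \<tau> \<sigma> G \<le> search_value G"
    if "strategy \<tau>" "graph G" "verts G \<noteq> {}" for \<tau> and G :: "('a, 'b) pre_digraph"
    using that(2,3)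
  proof (induction "card (verts G)" arbitrary: G rule: less_induct)
    case less
    interpret graph G by fact
    have IH: "search_value H \<le> win_prob \<sigma> \<tau> H \<and> win_prob \<tau> \<sigma> H \<le> search_value H"
      if "v \<in> verts G" "H \<in> components_without G v" for H v
      by (intro less.hyps card_components_without_less[OF finite_verts that]
          components_without_graph[OF less.prems(1) that(2)] components_without_verts(2)[OF that(2)])
    have \<sigma>G: "\<sigma> G \<in> verts G" "g G (\<sigma> G) = search_value G"
      using \<sigma>[of G] less.prems by auto
    have \<tau>G: "\<tau> G \<in> verts G"
      using that(1) less.prems by (auto simp: strategy_def)
    have "g G (\<sigma> G) \<le> win_prob \<sigma> \<tau> G"
      unfolding g_def win_prob_rec[of G \<sigma>, OF less.prems(1) \<sigma>G(1)]
      using IH[OF \<sigma>G(1)]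
      by (intro add_left_mono sum_mono mult_left_mono) simp_all
    moreover have "win_prob \<tau> \<sigma> G \<le> g G (\<tau> G)"
      unfolding g_def win_prob_rec[of G \<tau>, OF less.prems(1) \<tau>G]
      using IH[OF \<tau>G]
      by (intro add_left_mono sum_mono mult_left_mono) simp_all
    moreover have "g G (\<tau> G) \<le> search_value G"
      using \<tau>G val[of G] less.prems by auto
    ultimately show ?case using \<sigma>G(2) by linarith
  qed
  moreover have "strategy \<sigma>" using \<sigma> by (auto simp: strategy_def)
  ultimately show ?thesis by blast
qed

end

theory Submission
  imports Defs
begin

text \<open>
  Write \<open>f n = (n + 1) div 2\<close>; the claim is that the player to move wins for exactly \<open>f n\<close> of
  the \<open>n\<close> possible targets. Suppose this holds for all smaller positions. A guess that leaves
  components of sizes \<open>a\<^sub>1, \<dots>, a\<^sub>k\<close>, with sum \<open>n - 1\<close>, wins at once for one target, and in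
  the \<open>i\<close>-th component for the \<open>a\<^sub>i - f a\<^sub>i = a\<^sub>i div 2\<close> targets on which the opponent loses. So
  the guess is worth \<open>1 + (\<Sum>i. a\<^sub>i div 2)\<close>, which is at most \<open>1 + (n - 1) div 2 = f n\<close>, with
  equality exactly if at most one \<open>a\<^sub>i\<close> is odd. It remains to find a guess of this kind.

  Among all components of odd size that arise by deleting one vertex, let \<open>H\<close> be a smallest one,
  arising by deletion of \<open>v\<close>, and guess any \<open>w\<close> in \<open>H\<close>
  (if no such component is odd, any guess will do). A component left by \<open>w\<close> that avoids \<open>v\<close> lies
  properly inside \<open>H\<close> (lemma \<open>component_avoiding_psubset\<close>), so it is even by minimality, and
  only the component that contains \<open>v\<close> can be odd (lemma \<open>ex_at_most_one_odd_component\<close>).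

  Components are again connected graphs, and these form the class over which the induction runs.
\<close>

lemma component_reachable_closed:
  assumes "graph G" "H \<in> components_without G v"
    and "x \<rightarrow>\<^sup>*\<^bsub>pre_digraph.del_vert G v\<^esub> w" "w \<in> verts H"
  shows "x \<in> verts H"
proof -
  let ?D = "pre_digraph.del_vert G v"
  interpret D: graph ?D using assms(1) by (rule graph_del_vert)
  have S: "verts H \<in> D.sccs_verts"
    using assms(2) by (simp add: D.sccs_verts_conv)
  have "w \<rightarrow>\<^sup>*\<^bsub>?D\<^esub> x"
    using assms(3) by (rule D.symmetric_reachable')
  with S assms(3,4) show ?thesis
    unfolding D.in_sccs_verts_conv_reachable by blast
qed

text \<open>
  A walk in \<open>G\<close> from a vertex of \<open>K\<close> to \<open>w\<close> can leave \<open>K\<close> only through \<open>w\<close>. So until it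
  first meets \<open>w\<close> it stays in \<open>K\<close>, hence avoids \<open>v\<close>, and connects its starting point to \<open>w\<close>
  inside \<open>G - v\<close>.
\<close>
lemma component_avoiding_psubset:
  assumes G: "graph G" "strongly_connected G"
    and H: "H \<in> components_without G v" "w \<in> verts H"
    and K: "K \<in> components_without G w" "v \<notin> verts K"
  shows "verts K \<subset> verts H"
proof -
  interpret G: graph G by (rule G(1))
  let ?Dv = "pre_digraph.del_vert G v" and ?Dw = "pre_digraph.del_vert G w"
  interpret Dv: graph ?Dv using G(1) by (rule graph_del_vert)
  interpret Dw: graph ?Dw using G(1) by (rule graph_del_vert)
  have w: "w \<in> verts G" "w \<noteq> v"
    using components_without_verts(1)[OF H(1)] H(2) by auto
  have arc: "x \<rightarrow>\<^bsub>pre_digraph.del_vert G u\<^esub> y" if xy: "x \<rightarrow>\<^bsub>G\<^esub> y" "x \<noteq> u" "y \<noteq> u" for x y u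
  proof -
    obtain e where e: "(x, y) = arc_to_ends G e" "e \<in> arcs G"
      using xy(1) unfolding arcs_ends_def by (rule imageE)
    then have "e \<in> arcs (pre_digraph.del_vert G u)"
      using xy(2,3) by (simp add: pre_digraph.arcs_del_vert arc_to_ends_def)
    moreover have "(x, y) = arc_to_ends (pre_digraph.del_vert G u) e"
      using e(1) by (simp only: pre_digraph.ends_del_vert)
    ultimately show ?thesis
      unfolding arcs_ends_def by (intro image_eqI)
  qed
  have Kw: "w \<notin> verts K" "verts K \<subseteq> verts G"
    using components_without_verts(1)[OF K(1)] by auto
  have reach: "x \<rightarrow>\<^sup>*\<^bsub>?Dv\<^esub> w" if "x \<rightarrow>\<^sup>*\<^bsub>G\<^esub> w" "x \<in> verts K" for x
    using that
  proof (induction rule: G.converse_reachable_induct)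
    case base
    then show ?case using Kw by simp
  next
    case (step x y)
    have x: "x \<noteq> v" "x \<noteq> w"
      using step.prems K(2) Kw(1) by auto
    show ?case
    proof (cases "y = w")
      case True
      then have "x \<rightarrow>\<^bsub>?Dv\<^esub> w"
        using arc[OF step.hyps(1) x(1)] w(2) by simp
      then show ?thesis by (rule Dv.reachable_adjI)
    next
      case False
      have "x \<rightarrow>\<^bsub>?Dw\<^esub> y"
        using step.hyps(1) x(2) False by (rule arc)
      then have "y \<rightarrow>\<^sup>*\<^bsub>?Dw\<^esub> x"
        by (rule Dw.symmetric_reachable'[OF Dw.reachable_adjI])
      then have y: "y \<in> verts K"
        by (rule component_reachable_closed[OF G(1) K(1) _ step.prems])
      then have "x \<rightarrow>\<^bsub>?Dv\<^esub> y"
        using arc[OF step.hyps(1) x(1)] K(2) by auto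
      then show ?thesis
        using step.IH[OF y] by (rule Dv.adj_reachable_trans)
    qed
  qed
  have "verts K \<subseteq> verts H"
  proof
    fix x assume x: "x \<in> verts K"
    then have "x \<rightarrow>\<^sup>*\<^bsub>G\<^esub> w"
      using G(2) Kw(2) w(1) by (auto simp: strongly_connected_def)
    then show "x \<in> verts H"
      by (intro component_reachable_closed[OF G(1) H(1) _ H(2)] reach x)
  qed
  with H(2) Kw(1) show ?thesis by blast
qed

text \<open>
  This is the optimal guess. Descent on the size of odd components: after moving from \<open>v\<close> to a
  vertex of a smallest one, every odd component must contain \<open>v\<close>, and components are disjoint.
\<close>
lemma ex_at_most_one_odd_component:
  assumes "graph G" "strongly_connected G"
  shows "\<exists>w \<in> verts G. \<forall>K \<in> components_without G w. \<forall>L \<in> components_without G w.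
           odd (card (verts K)) \<and> odd (card (verts L)) \<longrightarrow> K = L"
proof -
  interpret graph G by (rule assms(1))
  define P where "P = (\<lambda>(v, H). v \<in> verts G \<and> H \<in> components_without G v \<and> odd (card (verts H)))"
  show ?thesis
  proof (cases "\<exists>vH. P vH")
    case False
    moreover have "verts G \<noteq> {}"
      using assms(2) by (simp add: strongly_connected_def)
    ultimately show ?thesis
      unfolding P_def by fastforce
  next
    case True
    then obtain vH where vH: "P vH" and min: "\<And>uK. P uK \<Longrightarrow> card (verts (snd vH)) \<le> card (verts (snd uK))"
      using ex_has_least_nat[of P _ "\<lambda>vH. card (verts (snd vH))"] by blast
    obtain v H where vH_eq: "vH = (v, H)" by (cases vH)
    have v: "v \<in> verts G" and H: "H \<in> components_without G v"
      using vH by (simp_all add: P_def vH_eq)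
    obtain w where w: "w \<in> verts H"
      using components_without_verts(2)[OF H] by blast
    have wG: "w \<in> verts G"
      using components_without_verts(1)[OF H] w by blast
    have finH: "finite (verts H)"
      using components_without_verts(1)[OF H] by (rule finite_subset) simp
    have vK: "v \<in> verts K" if K: "K \<in> components_without G w" and "odd (card (verts K))" for K
    proof (rule ccontr)
      assume "v \<notin> verts K"
      then have "card (verts K) < card (verts H)"
        by (intro psubset_card_mono finH component_avoiding_psubset[OF assms H w K])
      moreover have "card (verts H) \<le> card (verts K)"
        using min[of "(w, K)"] that wG by (simp add: P_def vH_eq)
      ultimately show False by simp
    qed
    show ?thesis
    proof (intro bexI[OF _ wG] ballI impI)
      fix K L assume KL: "K \<in> components_without G w" "L \<in> components_without G w"
        and "odd (card (verts K)) \<and> odd (card (verts L))"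
      then have "v \<in> verts K \<inter> verts L" using vK by blast
      then show "K = L"
        using components_without_disjoint[OF assms(1) KL] by blast
    qed
  qed
qed

lemma sum_div2_le:
  fixes f :: "'c \<Rightarrow> nat"
  shows "(\<Sum>x\<in>A. f x div 2) \<le> (\<Sum>x\<in>A. f x) div 2"
  by (induction A rule: infinite_finite_induct) auto

lemma sum_div2_eq:
  fixes f :: "'c \<Rightarrow> nat"
  assumes "finite A" and one: "\<forall>x\<in>A. \<forall>y\<in>A. odd (f x) \<and> odd (f y) \<longrightarrow> x = y"
  shows "(\<Sum>x\<in>A. f x div 2) = (\<Sum>x\<in>A. f x) div 2"
proof -
  have even_case: "(\<Sum>x\<in>B. f x) = 2 * (\<Sum>x\<in>B. f x div 2)" if "\<forall>x\<in>B. even (f x)" for B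
    using that by (simp add: sum_distrib_left)
  show ?thesis
  proof (cases "\<exists>a\<in>A. odd (f a)")
    case True
    then obtain a where a: "a \<in> A" "odd (f a)" by blast
    then have "(\<Sum>x\<in>A - {a}. f x) = 2 * (\<Sum>x\<in>A - {a}. f x div 2)"
      using one by (intro even_case) blast
    then show ?thesis
      by (simp add: sum.remove[OF assms(1) a(1)])
  next
    case False
    then show ?thesis using even_case[of A] by simp
  qed
qed

text \<open>
  Scaled by the number of vertices, the value of a guess is the natural number
  \<open>1 + (\<Sum>H. card (verts H) div 2)\<close>, so both bounds are statements about halving.
\<close>
lemma search_value_connected:
  assumes "graph G" "strongly_connected G"
  shows "search_value G = real ((card (verts G) + 1) div 2) / real (card (verts G))"
  using assms
proof (induction "card (verts G)" arbitrary: G rule: less_induct)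
  case less
  interpret graph G by (rule less.prems(1))
  define n where "n = card (verts G)"
  define h where "h v = 1 + (\<Sum>H\<in>components_without G v. card (verts H) div 2)" for v
  have ne: "verts G \<noteq> {}"
    using less.prems(2) by (simp add: strongly_connected_def)
  then have n: "n > 0" by (simp add: n_def card_gt_0_iff)
  have guess: "1 / real n + (\<Sum>H\<in>components_without G v.
      real (card (verts H)) / real n * (1 - search_value H)) = real (h v) / real n"
    if v: "v \<in> verts G" for v
  proof -
    have "real (card (verts H)) / real n * (1 - search_value H) = real (card (verts H) div 2) / real n"
      if H: "H \<in> components_without G v" for H
    proof -
      have "strongly_connected H" using H by (simp add: pre_digraph.sccs_def)
      with components_without_graph[OF less.prems(1) H]
      have IH: "search_value H = real ((card (verts H) + 1) div 2) / real (card (verts H))"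
        by (rule less.hyps[OF card_components_without_less[OF finite_verts v H]])
      have "finite (verts H)"
        using components_without_verts(1)[OF H] by (rule finite_subset) simp
      then have pos: "card (verts H) > 0"
        using components_without_verts(2)[OF H] by (simp add: card_gt_0_iff)
      have "card (verts H) = (card (verts H) + 1) div 2 + card (verts H) div 2" by presburger
      then have "real (card (verts H)) - real ((card (verts H) + 1) div 2) = real (card (verts H) div 2)"
        by linarith
      then show ?thesis
        using pos by (simp add: IH right_diff_distrib diff_divide_distrib[symmetric])
    qed
    then have "(\<Sum>H\<in>components_without G v. real (card (verts H)) / real n * (1 - search_value H)) =
        (\<Sum>H\<in>components_without G v. real (card (verts H) div 2) / real n)"
      by (intro sum.cong refl)
    then show ?thesis
      by (simp only: h_def of_nat_add of_nat_1 of_nat_sum add_divide_distrib sum_divide_distrib)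
  qed
  have total: "(\<Sum>H\<in>components_without G v. card (verts H)) = n - 1" if v: "v \<in> verts G" for v
  proof -
    have "card (\<Union> (verts ` components_without G v)) = (\<Sum>H\<in>components_without G v. card (verts H))"
    proof (rule card_UN_disjoint)
      show "finite (components_without G v)"
        by (rule finite_components_without[OF less.prems(1)])
      show "\<forall>H\<in>components_without G v. finite (verts H)"
        using components_without_verts(1)[of _ G v] by (meson finite_Diff finite_subset finite_verts)
      show "\<forall>H\<in>components_without G v. \<forall>K\<in>components_without G v.
          H \<noteq> K \<longrightarrow> verts H \<inter> verts K = {}"
        using components_without_disjoint[OF less.prems(1)] by blast
    qed
    then show ?thesis
      using v by (simp add: Un_components_without[OF less.prems(1)] n_def)
  qed
  have half: "1 + (n - 1) div 2 = (n + 1) div 2"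
    using n by presburger
  have upper: "h v \<le> (n + 1) div 2" if "v \<in> verts G" for v
    using sum_div2_le[of "\<lambda>H. card (verts H)" "components_without G v"] total[OF that] half
    by (simp add: h_def)
  obtain w where w: "w \<in> verts G"
    and "\<forall>K \<in> components_without G w. \<forall>L \<in> components_without G w.
           odd (card (verts K)) \<and> odd (card (verts L)) \<longrightarrow> K = L"
    using ex_at_most_one_odd_component[OF less.prems] by blast
  then have hw: "h w = (n + 1) div 2"
    using sum_div2_eq[OF finite_components_without[OF less.prems(1)], of w "\<lambda>H. card (verts H)"]
      total[OF w] half
    by (simp add: h_def)
  have "search_value G = Max ((\<lambda>v. real (h v) / real n) ` verts G)"
    using ne guess by (subst search_value.simps) (simp add: n_def cong: image_cong)
  also have "\<dots> = real ((n + 1) div 2) / real n"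
  proof (rule Max_eqI)
    show "y \<le> real ((n + 1) div 2) / real n" if "y \<in> (\<lambda>v. real (h v) / real n) ` verts G" for y
      using that upper by (auto intro!: divide_right_mono simp del: of_nat_add)
    show "real ((n + 1) div 2) / real n \<in> (\<lambda>v. real (h v) / real n) ` verts G"
      using w hw by force
  qed simp
  finally show ?case by (simp add: n_def)
qed

theorem theorem3p1:
  fixes T :: "('a, 'b) pre_digraph" and n :: nat
  assumes "undirected_tree T" and "card (verts T) = n"
  shows "search_value T = 1 / 2 + 1 / (2 * real n) * of_bool (odd n)"
proof -
  have T: "graph T" "Digraph_Component.connected T"
    using assms(1) by (simp_all add: undirected_tree_def)
  interpret graph T by (rule T(1))
  have sc: "strongly_connected T"
    using sym_arcs T(2) by (rule symmetric_connected_imp_strongly_connected)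
  then have n: "n > 0"
    using assms(2) by (auto simp: strongly_connected_def card_gt_0_iff)
  have "search_value T = real ((n + 1) div 2) / real n"
    using search_value_connected[OF T(1) sc] assms(2) by simp
  also have "real ((n + 1) div 2) = (real n + of_bool (odd n)) / 2"
    by (cases "even n") (auto elim!: evenE oddE)
  finally show ?thesis
    using n by (simp add: field_simps)
qed

end
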